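(* Let $p$ be a prime, let $r,e,m\ge1$ and $s\ge0$ be integers with $\gcd(m,p)=1$ and such that $n=mp^s$ is odd; put $q=p^r$ and $R=\mathbb{F}_{p^r}[u]/\langle u^e\rangle$. Let $\lambda\in\mathbb{F}_{q}^*$ be such that there exists $\delta\in\mathbb{F}_q^*$ with $\delta^m=\lambda$. Then the following hold: (i) $\pm\lambda$-constacyclic codes of length $mp^s$ over $R$ are equivalent to cyclic codes over $R$; (ii) if $p^r\equiv 1\pmod 4$ and $\delta=\beta^2$ for some $\beta\in\mathbb{F}_q$, then $\pm\lambda$-constacyclic codes of length $2mp^s$ over $R$ are equivalent to cyclic codes over $R$.
   Context: $R=\mathbb{F}_{p^r}[u]/\langle u^e\rangle=\mathbb{F}_{p^r}+u\mathbb{F}_{p^r}+\cdots+u^{e-1}\mathbb{F}_{p^r}$ with $u^e=0$. For a unit $\lambda\in R$, a $\lambda$-constacyclic code of length $N$ over $R$ is an $R$-submodule of $R^N$ closed under $(c_0,\dots,c_{N-1})\mapsto(\lambda c_{N-1},c_0,\dots,c_{N-2})$; a cyclic code is a $1$-constacyclic code. Two linear codes of the same length over $R$ are equivalent if one is obtained from the other by a monomial transformation, i.e. a permutation of coordinates combined with multiplication of each coordinate by a unit of $R$. The assertion is that each $\lambda$-constacyclic code and each $(-\lambda)$-constacyclic code of the stated length is equivalent to some cyclic code of the same length. *)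

theory Defs
  imports
    "HOL-Combinatorics.Permutations"
    "HOL-Number_Theory.Cong"
    "HOL-Algebra.Module"
    "HOL-Algebra.QuotRing"
    "HOL-Algebra.UnivPoly"
begin

text \<open>The ring \<open>K[u]/\<langle>u\<^sup>e\<rangle>\<close> and the canonical image in it of an element of \<open>K\<close>.\<close>

definition trunc_ideal :: "('a, 'm) ring_scheme \<Rightarrow> nat \<Rightarrow> (nat \<Rightarrow> 'a) set" where
  "trunc_ideal K e = PIdl\<^bsub>UP K\<^esub> (monom (UP K) \<one>\<^bsub>K\<^esub> e)"

definition trunc_ring :: "('a, 'm) ring_scheme \<Rightarrow> nat \<Rightarrow> (nat \<Rightarrow> 'a) set ring" where
  "trunc_ring K e = UP K Quot trunc_ideal K e"

definition trunc_const :: "('a, 'm) ring_scheme \<Rightarrow> nat \<Rightarrow> 'a \<Rightarrow> (nat \<Rightarrow> 'a) set" where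
  "trunc_const K e a = trunc_ideal K e +>\<^bsub>UP K\<^esub> monom (UP K) a 0"

text \<open>
  The \<open>R\<close>-module \<open>R\<^sup>N\<close>. A word \<open>(c\<^sub>0, \<dots>, c\<^bsub>N-1\<^esub>)\<close> is an extensional function on \<open>{..<N}\<close>.
  The library's module record extends the ring record, so a product and a unit have to be
  supplied as well; they are componentwise and play no role for the module structure.
\<close>

definition word_module :: "('r, 'm) ring_scheme \<Rightarrow> nat \<Rightarrow> ('r, nat \<Rightarrow> 'r) module" where
  "word_module R N =
    \<lparr>carrier = {..<N} \<rightarrow>\<^sub>E carrier R,
     mult = (\<lambda>c d. \<lambda>i\<in>{..<N}. c i \<otimes>\<^bsub>R\<^esub> d i),
     one = (\<lambda>i\<in>{..<N}. \<one>\<^bsub>R\<^esub>),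
     zero = (\<lambda>i\<in>{..<N}. \<zero>\<^bsub>R\<^esub>),
     add = (\<lambda>c d. \<lambda>i\<in>{..<N}. c i \<oplus>\<^bsub>R\<^esub> d i),
     smult = (\<lambda>a c. \<lambda>i\<in>{..<N}. a \<otimes>\<^bsub>R\<^esub> c i)\<rparr>"

definition linear_code :: "('r, 'm) ring_scheme \<Rightarrow> nat \<Rightarrow> (nat \<Rightarrow> 'r) set \<Rightarrow> bool" where
  "linear_code R N C \<longleftrightarrow> submodule C R (word_module R N)"

definition constacyclic_shift ::
    "('r, 'm) ring_scheme \<Rightarrow> nat \<Rightarrow> 'r \<Rightarrow> (nat \<Rightarrow> 'r) \<Rightarrow> nat \<Rightarrow> 'r" where
  "constacyclic_shift R N l c =
    (\<lambda>i\<in>{..<N}. if i = 0 then l \<otimes>\<^bsub>R\<^esub> c (N - 1) else c (i - 1))"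

text \<open>Meant for a unit \<open>l\<close> of \<open>R\<close>; this is not repeated inside the definition.\<close>

definition constacyclic_code ::
    "('r, 'm) ring_scheme \<Rightarrow> nat \<Rightarrow> 'r \<Rightarrow> (nat \<Rightarrow> 'r) set \<Rightarrow> bool" where
  "constacyclic_code R N l C \<longleftrightarrow>
    linear_code R N C \<and> (\<forall>c\<in>C. constacyclic_shift R N l c \<in> C)"

definition cyclic_code :: "('r, 'm) ring_scheme \<Rightarrow> nat \<Rightarrow> (nat \<Rightarrow> 'r) set \<Rightarrow> bool" where
  "cyclic_code R N C \<longleftrightarrow> constacyclic_code R N \<one>\<^bsub>R\<^esub> C"

definition monomial_map ::
    "('r, 'm) ring_scheme \<Rightarrow> nat \<Rightarrow> (nat \<Rightarrow> nat) \<Rightarrow> (nat \<Rightarrow> 'r) \<Rightarrow> (nat \<Rightarrow> 'r) \<Rightarrow> nat \<Rightarrow> 'r" where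
  "monomial_map R N \<pi> v c = (\<lambda>i\<in>{..<N}. v i \<otimes>\<^bsub>R\<^esub> c (\<pi> i))"

definition code_equivalent ::
    "('r, 'm) ring_scheme \<Rightarrow> nat \<Rightarrow> (nat \<Rightarrow> 'r) set \<Rightarrow> (nat \<Rightarrow> 'r) set \<Rightarrow> bool" where
  "code_equivalent R N C D \<longleftrightarrow>
    (\<exists>\<pi> v. \<pi> permutes {..<N} \<and> v \<in> {..<N} \<rightarrow> Units R \<and> D = monomial_map R N \<pi> v ` C)"

definition constacyclic_equivalent_to_cyclic ::
    "('r, 'm) ring_scheme \<Rightarrow> nat \<Rightarrow> 'r \<Rightarrow> bool" where
  "constacyclic_equivalent_to_cyclic R N l \<longleftrightarrow>
    (\<forall>C. constacyclic_code R N l C \<longrightarrow> (\<exists>D. cyclic_code R N D \<and> code_equivalent R N C D))"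

lemma trunc_ring_cring:
  assumes "cring K"
  shows "cring (trunc_ring K e)"
proof -
  interpret UP_cring K "UP K" using assms by (simp add: UP_cring_def)
  show ?thesis unfolding trunc_ring_def trunc_ideal_def
    by (intro ideal.quotient_is_cring P.cgenideal_ideal monom_closed) (simp_all add: UP_cring)
qed

lemma trunc_const_Units:
  assumes "field K" "a \<in> carrier K" "a \<noteq> \<zero>\<^bsub>K\<^esub>"
  shows "trunc_const K e a \<in> Units (trunc_ring K e)"
proof -
  interpret K: field K by fact
  interpret UP_cring K "UP K" by (simp add: UP_cring_def K.is_cring)
  have I: "ideal (trunc_ideal K e) (UP K)" unfolding trunc_ideal_def
    by (intro P.cgenideal_ideal monom_closed) simp
  have h: "trunc_const K e \<in> ring_hom K (trunc_ring K e)"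
    unfolding trunc_const_def trunc_ring_def
    using ring_hom_trans[OF _ ideal.rcos_ring_hom[OF I]] const_ring_hom
    by (force simp: comp_def)
  interpret T: cring "trunc_ring K e" by (rule trunc_ring_cring) (rule K.is_cring)
  have "a \<in> Units K" using assms K.field_Units by simp
  then have "inv\<^bsub>K\<^esub> a \<in> carrier K" "a \<otimes>\<^bsub>K\<^esub> inv\<^bsub>K\<^esub> a = \<one>\<^bsub>K\<^esub>" by auto
  then have "trunc_const K e (inv\<^bsub>K\<^esub> a) \<in> carrier (trunc_ring K e)"
    "trunc_const K e a \<otimes>\<^bsub>trunc_ring K e\<^esub> trunc_const K e (inv\<^bsub>K\<^esub> a) =
      \<one>\<^bsub>trunc_ring K e\<^esub>"
    using ring_hom_closed[OF h] ring_hom_mult[OF h assms(2)] ring_hom_one[OF h] by metis+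
  moreover have "trunc_const K e a \<in> carrier (trunc_ring K e)"
    using ring_hom_closed[OF h assms(2)] .
  ultimately show ?thesis unfolding Units_def using T.m_comm by fastforce
qed

lemma word_module_module:
  assumes "cring R"
  shows "module R (word_module R N)"
proof -
  interpret cring R by fact
  have ag: "abelian_group (word_module R N)"
  proof (rule abelian_groupI)
    fix x assume "x \<in> carrier (word_module R N)"
    then show "\<exists>y\<in>carrier (word_module R N).
        y \<oplus>\<^bsub>word_module R N\<^esub> x = \<zero>\<^bsub>word_module R N\<^esub>"
      by (intro bexI[of _ "\<lambda>i\<in>{..<N}. \<ominus>\<^bsub>R\<^esub> x i"])
        (auto simp: word_module_def PiE_iff l_neg intro!: restrict_ext)
  qed (auto simp: word_module_def PiE_iff a_ac extensional_def restrict_def fun_eq_iff)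
  show ?thesis
    by (rule moduleI[OF assms ag])
      (auto simp: word_module_def PiE_iff l_distr r_distr m_assoc extensional_def
        restrict_def fun_eq_iff)
qed

end

(* If mu is a unit of R with mu^N = l, scaling coordinate i by mu^i turns the l-constacyclic shift
   into mu times the cyclic shift, so l-constacyclic codes of length N are equivalent to cyclic
   ones. It remains to find N-th roots of l and -l among the constants. In a field with p^r elements
   the iterated Frobenius x -> x^(p^s) is onto, so a p^s-th root of delta is an n-th root of l, and
   its negative is an n-th root of -l as n is odd. For length 2n one takes a p^s-th root of beta,
   times a square root of -1 in the case of -l. *)
theory Submission
  imports Defs "HOL-Algebra.Multiplicative_Group"
begin

section \<open>Monomial images of codes over a commutative ring\<close>

text \<open>A monomial map is \<open>R\<close>-linear, commutativity letting scalars pass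
  \<open>v i\<close>, and a linear image of a submodule is a submodule.\<close>

lemma linear_code_monomial_image:
  assumes "cring R" "linear_code R N C" and v: "v \<in> {..<N} \<rightarrow> carrier R"
    and pi: "\<pi> permutes {..<N}"
  shows "linear_code R N (monomial_map R N \<pi> v ` C)"
proof -
  interpret M: Module.module R "word_module R N"
    using assms(1) by (rule word_module_module)
  let ?M = "word_module R N" and ?f = "monomial_map R N \<pi> v"
  have C: "submodule C R ?M"
    using assms(2) by (simp add: linear_code_def)
  have vc: "v i \<in> carrier R" and pi_less: "\<pi> i < N" if "i < N" for i
    using v that permutes_in_image[OF pi, of i] by auto
  have word: "c i \<in> carrier R" if "c \<in> carrier ?M" "i < N" for c i
    using that by (auto simp: word_module_def)
  have f_closed: "?f c \<in> carrier ?M" if "c \<in> carrier ?M" for c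
    using word[OF that] vc pi_less by (auto simp: word_module_def monomial_map_def)
  have f_add: "?f (c \<oplus>\<^bsub>?M\<^esub> d) = ?f c \<oplus>\<^bsub>?M\<^esub> ?f d"
    if "c \<in> carrier ?M" "d \<in> carrier ?M" for c d
    using word[OF that(1)] word[OF that(2)] vc pi_less
    by (auto simp: word_module_def monomial_map_def M.R.r_distr)
  have f_smult: "?f (a \<odot>\<^bsub>?M\<^esub> c) = a \<odot>\<^bsub>?M\<^esub> ?f c"
    if "a \<in> carrier R" "c \<in> carrier ?M" for a c
    using that(1) word[OF that(2)] vc pi_less
    by (auto simp: word_module_def monomial_map_def M.R.m_lcomm)
  note C_sub = M.submoduleE(1)[OF C, THEN subsetD]
  have smult: "a \<odot>\<^bsub>?M\<^esub> x \<in> ?f ` C" if "a \<in> carrier R" "x \<in> ?f ` C" for a x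
  proof -
    from that(2) obtain c where "c \<in> C" "x = ?f c" by blast
    then show ?thesis
      using that(1) f_smult[OF _ C_sub, of a c] M.submoduleE(4)[OF C, of a c]
      by (metis imageI)
  qed
  have sub: "?f ` C \<subseteq> carrier ?M"
    using f_closed C_sub by auto
  have minus: "\<ominus>\<^bsub>?M\<^esub> x \<in> ?f ` C" if "x \<in> ?f ` C" for x
  proof -
    have "x \<in> carrier ?M" using that sub by blast
    then have "\<ominus>\<^bsub>?M\<^esub> x = (\<ominus>\<^bsub>R\<^esub> \<one>\<^bsub>R\<^esub>) \<odot>\<^bsub>?M\<^esub> x"
      using M.smult_l_minus[of "\<one>\<^bsub>R\<^esub>" x] by simp
    then show ?thesis
      using smult[OF _ that, of "\<ominus>\<^bsub>R\<^esub> \<one>\<^bsub>R\<^esub>"] by simp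
  qed
  obtain x where "x \<in> ?f ` C"
    using M.submoduleE(2)[OF C] by blast
  moreover from this have "\<zero>\<^bsub>R\<^esub> \<odot>\<^bsub>?M\<^esub> x = \<zero>\<^bsub>?M\<^esub>"
    using sub by (intro M.smult_l_null) auto
  ultimately have zero: "\<zero>\<^bsub>?M\<^esub> \<in> ?f ` C"
    using smult[of "\<zero>\<^bsub>R\<^esub>" x] by simp
  have add: "x \<oplus>\<^bsub>?M\<^esub> y \<in> ?f ` C" if "x \<in> ?f ` C" "y \<in> ?f ` C" for x y
  proof -
    from that obtain c d where "c \<in> C" "x = ?f c" "d \<in> C" "y = ?f d" by blast
    then show ?thesis
      using f_add[OF C_sub C_sub, of c d] M.submoduleE(5)[OF C, of c d] by (metis imageI)
  qed
  show ?thesis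
    unfolding linear_code_def by (rule M.submoduleI[OF sub zero minus add smult])
qed

lemma constacyclic_equivalent_to_cyclic_if_root:
  assumes "cring R" and mu: "\<mu> \<in> Units R" "\<mu> [^]\<^bsub>R\<^esub> N = l"
  shows "constacyclic_equivalent_to_cyclic R N l"
  unfolding constacyclic_equivalent_to_cyclic_def
proof (intro allI impI)
  interpret R: cring R by fact
  fix C assume C: "constacyclic_code R N l C"
  let ?v = "\<lambda>i. \<mu> [^]\<^bsub>R\<^esub> (i::nat)"
  let ?f = "monomial_map R N id ?v" and ?k = "inv\<^bsub>R\<^esub> \<mu>" and ?M = "word_module R N"
  have lin: "linear_code R N C" and shift: "\<And>c. c \<in> C \<Longrightarrow> constacyclic_shift R N l c \<in> C"
    using C by (auto simp: constacyclic_code_def)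
  have v_Units: "?v i \<in> Units R" for i
    using mu(1) by (induction i) auto
  then have v_closed: "?v i \<in> carrier R" for i by blast
  interpret M: Module.module R ?M
    using assms(1) by (rule word_module_module)
  have word: "c i \<in> carrier R" if "c \<in> C" "i < N" for c i
    using that lin M.submoduleE(1) by (fastforce simp: linear_code_def word_module_def)
  have D: "linear_code R N (?f ` C)"
    using assms(1) lin v_closed by (intro linear_code_monomial_image) (auto simp: permutes_id)
  have k: "?k \<in> carrier R"
    using mu(1) by simp
  \<comment> \<open>The power is unfolded with the new factor on the left, where it cancels against
    the inverse \<open>?k\<close>.\<close>
  have k_v: "?k \<otimes>\<^bsub>R\<^esub> ?v (Suc i) = ?v i" for i
  proof -
    have "?v (Suc i) = \<mu> \<otimes>\<^bsub>R\<^esub> ?v i"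
      using mu(1) by (intro R.nat_pow_Suc2) auto
    then show ?thesis
      using R.m_assoc[OF k _ v_closed[of i], of \<mu>] mu(1) v_closed[of i] by auto
  qed
  have "constacyclic_shift R N \<one>\<^bsub>R\<^esub> (?f c) = ?k \<odot>\<^bsub>?M\<^esub> ?f (constacyclic_shift R N l c)"
    if c: "c \<in> C" for c
  proof
    fix i
    consider "i \<ge> N" | "i = 0" "N > 0" | j where "i = Suc j" "Suc j < N"
      by (metis gr0I leI not0_implies_Suc)
    then show "constacyclic_shift R N \<one>\<^bsub>R\<^esub> (?f c) i =
        (?k \<odot>\<^bsub>?M\<^esub> ?f (constacyclic_shift R N l c)) i"
    proof cases
      \<comment> \<open>The wrap-around coordinate is where \<open>\<mu> [^] N = l\<close> enters:
        the factor \<open>l\<close> of the shift, divided by \<mu>, is the scaling factor of the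
        last coordinate.\<close>
      case 2
      have "?k \<otimes>\<^bsub>R\<^esub> l = ?v (N - 1)"
        using k_v[of "N - 1"] mu(2) 2 by simp
      then show ?thesis
        using 2 k word[OF c] v_closed[of N] v_closed[of "N - 1"] mu(2)
        by (simp add: constacyclic_shift_def monomial_map_def word_module_def flip: R.m_assoc)
    next
      case 3
      then show ?thesis
        using k word[OF c] v_closed[of "Suc j"] k_v[of j]
        by (simp add: constacyclic_shift_def monomial_map_def word_module_def flip: R.m_assoc
            del: R.nat_pow_Suc Group.nat_pow_Suc)
    qed (simp add: constacyclic_shift_def word_module_def)
  qed
  moreover have "?k \<odot>\<^bsub>?M\<^esub> ?f (constacyclic_shift R N l c) \<in> ?f ` C" if "c \<in> C" for c
    using M.submoduleE(4)[OF D[unfolded linear_code_def] k] shift[OF that] by blast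
  ultimately have "cyclic_code R N (?f ` C)"
    using D unfolding cyclic_code_def constacyclic_code_def by auto
  moreover have "code_equivalent R N C (?f ` C)"
    unfolding code_equivalent_def
    by (rule exI[of _ id], rule exI[of _ ?v]) (use v_Units permutes_id in auto)
  ultimately show "\<exists>D. cyclic_code R N D \<and> code_equivalent R N C D" by blast
qed

section \<open>Transfer of roots from the field to the truncated polynomial ring\<close>

lemma trunc_const_ring_hom:
  assumes "cring K"
  shows "trunc_const K e \<in> ring_hom K (trunc_ring K e)"
proof -
  interpret UP_cring K "UP K" using assms by (simp add: UP_cring_def)
  have "ideal (trunc_ideal K e) (UP K)"
    unfolding trunc_ideal_def by (intro P.cgenideal_ideal monom_closed) simp
  from ring_hom_trans[OF const_ring_hom ideal.rcos_ring_hom[OF this]] show ?thesis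
    by (simp add: trunc_const_def[abs_def] trunc_ring_def comp_def)
qed

text \<open>Reduces everything to roots in \<open>K\<close>: the constant embedding preserves powers
  and sends nonzero elements to units.\<close>

lemma trunc_ring_constacyclic_equivalent_to_cyclic:
  assumes "field K" "\<mu> \<in> carrier K" "\<mu> \<noteq> \<zero>\<^bsub>K\<^esub>" "\<mu> [^]\<^bsub>K\<^esub> N = l"
  shows "constacyclic_equivalent_to_cyclic (trunc_ring K e) N (trunc_const K e l)"
proof -
  interpret K: field K by fact
  interpret h: ring_hom_cring K "trunc_ring K e" "trunc_const K e"
    using trunc_ring_cring[OF K.is_cring] trunc_const_ring_hom[OF K.is_cring] K.is_cring
    by (simp add: ring_hom_cring_def ring_hom_cring_axioms_def)
  have "trunc_const K e \<mu> [^]\<^bsub>trunc_ring K e\<^esub> N = trunc_const K e l"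
    using h.hom_pow[OF assms(2), of N] assms(4) by simp
  then show ?thesis
    by (rule constacyclic_equivalent_to_cyclic_if_root[OF h.S.is_cring
          trunc_const_Units[OF assms(1-3)]])
qed

section \<open>Roots in finite fields\<close>

text \<open>For nonzero \<open>a\<close> this is Lagrange's theorem in the multiplicative group,
  multiplied once more by \<open>a\<close>.\<close>

lemma (in field) pow_order_eq_self:
  assumes "finite (carrier R)" "a \<in> carrier R"
  shows "a [^] order R = a"
proof (cases "a = \<zero>")
  case True
  then show ?thesis
    using assms by (simp add: order_gt_0_iff_finite nat_pow_zero)
next
  case False
  have "a [^] order (mult_of R) = \<one>"
    using group.pow_order_eq_1[OF field_mult_group, of a] assms False
    by (simp add: mult_of_simps)
  then have "a [^] (order R - 1) \<otimes> a = a"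
    using assms by (simp add: order_mult_of)
  moreover have "order R > 0"
    using assms(1) by (simp add: order_gt_0_iff_finite)
  ultimately show ?thesis
    using nat_pow_Suc[of a "order R - 1"] by simp
qed

text \<open>Iterating \<open>a [^] (p ^ r) = a\<close> gives \<open>a [^] (p ^ (r * s)) = a\<close>.
  Since \<open>r \<ge> 1\<close>, the exponent factors as \<open>p ^ (r * s - s)\<close> times
  \<open>p ^ s\<close>, which yields an explicit root.\<close>

lemma (in field) frobenius_power_surj:
  assumes "finite (carrier R)" "order R = p ^ r" "r \<ge> 1" and a: "a \<in> carrier R"
  obtains b where "b \<in> carrier R" "b [^] (p ^ s) = a"
proof
  have "a [^] ((p ^ r) ^ k) = a" for k
  proof (induction k)
    case (Suc k)
    have "a [^] ((p ^ r) ^ Suc k) = (a [^] ((p ^ r) ^ k)) [^] (p ^ r)"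
      using a by (simp add: nat_pow_pow mult.commute)
    also have "\<dots> = a"
      using Suc.IH pow_order_eq_self[OF assms(1) a] assms(2) by simp
    finally show ?case .
  qed (use a in simp)
  moreover have "r * s - s + s = r * s"
    using assms(3) by simp
  ultimately show "(a [^] (p ^ (r * s - s))) [^] (p ^ s) = a"
    using a by (metis nat_pow_pow power_add power_mult)
qed (use a in simp)

text \<open>The multiplicative group is cyclic of order \<open>4 * k\<close>, so the
  \<open>k\<close>-th power of a generator has order 4, and its square is an element other than 1
  whose square is 1.\<close>

lemma (in field) exists_sqrt_minus_one:
  assumes "finite (carrier R)" "[order R = 1] (mod 4)"
  obtains i where "i \<in> carrier R" "i \<otimes> i = \<ominus> \<one>"
proof -
  obtain g where g: "g \<in> carrier (mult_of R)"
      and gen: "carrier (mult_of R) = {g [^] k | k::nat. k \<in> UNIV}"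
    using finite_field_mult_group_has_gen[OF assms(1)] by blast
  interpret G: group "mult_of R" by (rule field_mult_group)
  have gR: "g \<in> carrier R" using g by simp
  have fin: "finite (carrier (mult_of R))" using assms(1) by simp
  \<comment> \<open>In a finite group the powers with natural exponents already form the generated
    subgroup, here the whole group.\<close>
  have ord: "G.ord g = order R - 1"
    using G.generate_pow_card[OF g] G.generate_pow_on_finite_carrier[OF fin g] gen
      order_mult_of[OF assms(1)] by (simp add: order_def mult_of_simps)
  \<comment> \<open>This makes \<open>order R - 1\<close> positive, hence \<open>k > 0\<close>, so
    that \<open>4 * k\<close> cannot divide \<open>k * 2\<close> below.\<close>
  have "order R \<ge> 2"
    using card_mono[OF assms(1), of "{\<zero>, \<one>}"] by (simp add: order_def)
  then obtain k where k: "order R - 1 = 4 * k" "k > 0"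
    using assms(2) by (auto simp: cong_altdef_nat elim!: dvdE)
  let ?i = "g [^] k"
  have "?i [^] (2::nat) \<noteq> \<one>"
    using G.pow_eq_id[OF g, of "k * 2"] ord k gR
    by (auto simp: mult_of_simps nat_pow_pow dest: dvd_imp_le)
  then have "?i \<otimes> ?i \<noteq> \<one>"
    using gR by (simp add: numeral_2_eq_2)
  moreover have "(?i \<otimes> ?i) \<otimes> (?i \<otimes> ?i) = \<one>"
    using G.pow_eq_id[OF g, of "4 * k"] ord k gR
    by (simp add: mult_of_simps nat_pow_mult flip: mult_2)
  \<comment> \<open>In a domain only 1 and -1 square to 1.\<close>
  ultimately have "?i \<otimes> ?i = \<ominus> \<one>"
    using square_eq_one[of "?i \<otimes> ?i"] gR by blast
  then show ?thesis using that gR by blast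
qed

lemma (in cring) minus_one_pow_odd:
  assumes "odd (n::nat)"
  shows "(\<ominus> \<one>) [^] n = \<ominus> \<one>"
proof -
  obtain k where "n = Suc (2 * k)" using assms by (auto elim: oddE)
  moreover have "(\<ominus> \<one>) [^] (2 * k) = \<one>"
    using nat_pow_pow[of "\<ominus> \<one>" 2 k] by (simp add: numeral_2_eq_2 l_minus r_minus)
  ultimately show ?thesis by simp
qed

theorem theorem3p11:
  fixes K :: "('a, 'b) ring_scheme" and p r e m s n :: nat and l \<delta> :: 'a
  assumes "prime p" and "r \<ge> 1" and "e \<ge> 1" and "m \<ge> 1"
    and "coprime m p" and "n = m * p ^ s" and "odd n"
    and "field K" and "order K = p ^ r"
    and "l \<in> carrier K - {\<zero>\<^bsub>K\<^esub>}"
    and "\<delta> \<in> carrier K - {\<zero>\<^bsub>K\<^esub>}" and "\<delta> [^]\<^bsub>K\<^esub> m = l"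
  shows
    "(constacyclic_equivalent_to_cyclic (trunc_ring K e) n (trunc_const K e l) \<and>
      constacyclic_equivalent_to_cyclic (trunc_ring K e) n
        (\<ominus>\<^bsub>trunc_ring K e\<^esub> trunc_const K e l)) \<and>
     ([p ^ r = 1] (mod 4) \<and> (\<exists>\<beta>\<in>carrier K. \<delta> = \<beta> [^]\<^bsub>K\<^esub> (2::nat)) \<longrightarrow>
      constacyclic_equivalent_to_cyclic (trunc_ring K e) (2 * n) (trunc_const K e l) \<and>
      constacyclic_equivalent_to_cyclic (trunc_ring K e) (2 * n)
        (\<ominus>\<^bsub>trunc_ring K e\<^esub> trunc_const K e l))"
proof -
  interpret K: field K by fact
  let ?R = "trunc_ring K e"
  interpret h: ring_hom_cring K ?R "trunc_const K e"
    using trunc_ring_cring[OF K.is_cring] trunc_const_ring_hom[OF K.is_cring] K.is_cring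
    by (simp add: ring_hom_cring_def ring_hom_cring_axioms_def)
  have l: "l \<in> carrier K" "l \<noteq> \<zero>\<^bsub>K\<^esub>" and \<delta>: "\<delta> \<in> carrier K" using assms by auto
  \<comment> \<open>\<open>order\<close> is a cardinality and is 0 for an infinite carrier, so
    positivity gives finiteness.\<close>
  have "order K > 0" "n > 0"
    using assms by (auto simp: prime_gt_0_nat odd_pos)
  then have fin: "finite (carrier K)" by (simp add: K.order_gt_0_iff_finite)
  note frob = K.frobenius_power_surj[OF fin assms(9,2)]
  \<comment> \<open>An \<open>N\<close>-th root of a nonzero element is itself nonzero, because
    \<open>N > 0\<close>.\<close>
  have root: "constacyclic_equivalent_to_cyclic ?R N (trunc_const K e a)"
    if "N > 0" "\<mu> \<in> carrier K" "\<mu> [^]\<^bsub>K\<^esub> N = a" "a \<noteq> \<zero>\<^bsub>K\<^esub>" for N \<mu> a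
    using that K.nat_pow_zero[of N]
    by (intro trunc_ring_constacyclic_equivalent_to_cyclic[OF assms(8), of \<mu>]) auto
  \<comment> \<open>A root of \<open>l\<close> times a root \<xi> of -1 is a root of
    \<open>-l\<close>; the homomorphism turns the image of \<open>-l\<close> into the negative taken
    in \<open>?R\<close>.\<close>
  have neg: "constacyclic_equivalent_to_cyclic ?R N (\<ominus>\<^bsub>?R\<^esub> trunc_const K e l)"
    if N: "N > 0" and \<mu>: "\<mu> \<in> carrier K" "\<mu> [^]\<^bsub>K\<^esub> N = l"
      and \<xi>: "\<xi> \<in> carrier K" "\<xi> [^]\<^bsub>K\<^esub> N = \<ominus>\<^bsub>K\<^esub> \<one>\<^bsub>K\<^esub>" for N \<mu> \<xi>
  proof -
    have "(\<xi> \<otimes>\<^bsub>K\<^esub> \<mu>) [^]\<^bsub>K\<^esub> N = \<ominus>\<^bsub>K\<^esub> l"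
      using \<mu> \<xi> l by (simp add: K.nat_pow_distrib K.l_minus)
    moreover have "\<ominus>\<^bsub>K\<^esub> l \<noteq> \<zero>\<^bsub>K\<^esub>"
      using l K.minus_minus K.minus_zero by metis
    ultimately show ?thesis
      using root[OF N, of "\<xi> \<otimes>\<^bsub>K\<^esub> \<mu>"] \<mu> \<xi> l by simp
  qed
  obtain \<mu> where \<mu>: "\<mu> \<in> carrier K" "\<mu> [^]\<^bsub>K\<^esub> (p ^ s) = \<delta>"
    using frob[OF \<delta>] by blast
  have \<mu>_n: "\<mu> [^]\<^bsub>K\<^esub> n = l"
    using K.nat_pow_pow[OF \<mu>(1), of "p ^ s" m] \<mu>(2) assms(6,12) by (simp add: mult.commute)
  have two: "constacyclic_equivalent_to_cyclic ?R (2 * n) (trunc_const K e l) \<and>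
      constacyclic_equivalent_to_cyclic ?R (2 * n) (\<ominus>\<^bsub>?R\<^esub> trunc_const K e l)"
    if q: "[p ^ r = 1] (mod 4)" and \<beta>: "\<beta> \<in> carrier K" "\<delta> = \<beta> [^]\<^bsub>K\<^esub> (2::nat)" for \<beta>
  proof -
    obtain \<nu> where \<nu>: "\<nu> \<in> carrier K" "\<nu> [^]\<^bsub>K\<^esub> (p ^ s) = \<beta>"
      using frob[OF \<beta>(1)] by blast
    \<comment> \<open>Splitting \<open>2 * n\<close> in this order passes from \<nu> through \<beta>
      and \<delta> to \<open>l\<close>.\<close>
    have "\<nu> [^]\<^bsub>K\<^esub> (2 * n) = ((\<nu> [^]\<^bsub>K\<^esub> (p ^ s)) [^]\<^bsub>K\<^esub> (2::nat)) [^]\<^bsub>K\<^esub> m"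
      using \<nu>(1) by (simp add: K.nat_pow_pow assms(6) mult_ac)
    then have \<nu>_n: "\<nu> [^]\<^bsub>K\<^esub> (2 * n) = l"
      using \<nu>(2) \<beta>(2) assms(12) by simp
    obtain \<xi> where \<xi>: "\<xi> \<in> carrier K" "\<xi> \<otimes>\<^bsub>K\<^esub> \<xi> = \<ominus>\<^bsub>K\<^esub> \<one>\<^bsub>K\<^esub>"
      using K.exists_sqrt_minus_one[OF fin] q assms(9) by auto
    then have "\<xi> [^]\<^bsub>K\<^esub> (2::nat) = \<ominus>\<^bsub>K\<^esub> \<one>\<^bsub>K\<^esub>"
      by (simp add: numeral_2_eq_2)
    \<comment> \<open>This power is \<open>(-1)^n\<close>, with \<open>n\<close> odd.\<close>
    then have "\<xi> [^]\<^bsub>K\<^esub> (2 * n) = \<ominus>\<^bsub>K\<^esub> \<one>\<^bsub>K\<^esub>"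
      using \<xi>(1) K.minus_one_pow_odd[OF assms(7)] K.nat_pow_pow[OF \<xi>(1), of 2 n] by simp
    then show ?thesis
      using root[OF _ \<nu>(1) \<nu>_n] neg[OF _ \<nu>(1) \<nu>_n \<xi>(1)] \<open>n > 0\<close> l by simp
  qed
  \<comment> \<open>At length \<open>n\<close> the root of -1 passed to \<open>neg\<close> is -1
    itself.\<close>
  have "constacyclic_equivalent_to_cyclic ?R n (trunc_const K e l)"
    "constacyclic_equivalent_to_cyclic ?R n (\<ominus>\<^bsub>?R\<^esub> trunc_const K e l)"
    using root[OF \<open>n > 0\<close> \<mu>(1) \<mu>_n] l K.minus_one_pow_odd[OF assms(7)]
      neg[OF \<open>n > 0\<close> \<mu>(1) \<mu>_n, of "\<ominus>\<^bsub>K\<^esub> \<one>\<^bsub>K\<^esub>"] by auto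
  with two show ?thesis by blast
qed

end
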